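(* Let $R,T,D,S\in\mathbb Q[x,q,p,z]$ be the explicit polynomials defined in the context, put $(f_1,f_2,f_3,f_4)=(R,T,D,S)$ and $$\delta_1=H_D,\qquad \delta_2=H_S,\qquad \delta_3=-H_R,\qquad \delta_4=-H_T,$$ where $H_F=\{F,\cdot\}$ is the Hamiltonian derivation of $F$. Then the assignment $$\widehat\Phi:\mathcal A_4\to\mathcal A_4,\qquad X_i\mapsto f_i,\qquad \partial_i\mapsto\delta_i\qquad(1\le i\le 4),$$ defines an algebra endomorphism of the fourth Weyl algebra $\mathcal A_4$ that is not an automorphism. Consequently, the conjecture $\mathrm{DC}(4)$ is false.
   Context: Let $\mathcal B=\mathbb C[X_1,X_2,X_3,X_4]$ with $(X_1,X_2,X_3,X_4)$ identified with $(x,q,p,z)$. The fourth Weyl algebra is $\mathcal A_4=\mathbb C\langle X_1,\dots,X_4,\partial_1,\dots,\partial_4\rangle$ with relations $[\partial_i,X_j]=\delta_{ij}$ (Kronecker delta) and $[X_i,X_j]=[\partial_i,\partial_j]=0$; it acts faithfully as the ring of polynomial differential operators on $\mathcal B$. Elements of $\mathcal B$ are regarded as elements of $\mathcal A_4$ (multiplication operators). $\mathrm{DC}(4)$ is the assertion that every $\mathbb C$-algebra endomorphism of $\mathcal A_4$ is an automorphism. The Poisson bracket on $\mathcal B=\mathbb C[x,q,p,z]$ is $\{f,g\}=f_p g_x-f_x g_p+f_z g_q-f_q g_z$. For $F\in\mathcal B$, $$H_F=\{F,\cdot\}=F_p\partial_x+F_z\partial_q-F_x\partial_p-F_q\partial_z,$$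 a first-order differential operator with polynomial coefficients, hence an element of $\mathcal A_4$ (here $\partial_x,\partial_q,\partial_p,\partial_z$ are $\partial_1,\partial_2,\partial_3,\partial_4$). Define polynomials in $\mathbb Q[x,q,p,z]$ as follows (the polynomial $H$ without subscript is distinct from the derivations $H_F$): $$a=1-3xq,\qquad B=3x^2p+2az,\qquad \beta=B-9q^2,\qquad y=q-\frac{x\beta}{3},\qquad u=xy,$$ $$R=2x-3x^2y-x^3\beta,$$ $$S=y+3x(1+u)^2\beta+3xy^2(4+3u),$$ $$T=-\frac12\left((1+u)^3\beta+y^2(1+u)(4+3u)\right),$$ $$D_0=\frac{1+3xq}{2}\,p-3q^2z,$$ $$H=\frac{y^4}{20}(18u^2+78u+125)+\frac{3\beta y^2}{10}(u^3+5u^2+10u-5)-\frac{\beta^2}{6}(9u+2)-\frac{x^2\beta^3}{6},$$ $$D=D_0+H.$$ *)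

theory Defs
  imports Complex_Main "HOL-Library.Poly_Mapping" "HOL-Library.Numeral_Type"
begin

section \<open>Free associative algebras\<close>

datatype 'g free_monoid = Word (letters: "'g list")

instantiation free_monoid :: (type) monoid_add
begin

definition zero_free_monoid :: "'a free_monoid" where
  "0 = Word []"

definition plus_free_monoid :: "'a free_monoid \<Rightarrow> 'a free_monoid \<Rightarrow> 'a free_monoid" where
  "v + w = Word (letters v @ letters w)"

instance
  by standard (simp_all add: zero_free_monoid_def plus_free_monoid_def)

end

text \<open>
  The free complex algebra is the monoid algebra of the free monoid.  The convolution product of
  \<open>Poly_Mapping\<close> expects the monoid of exponents in additive notation, hence the (noncommutative)
  addition above, which is concatenation of words.
\<close>

type_synonym 'g free_algebra = "'g free_monoid \<Rightarrow>\<^sub>0 complex"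

definition free_scalar :: "complex \<Rightarrow> 'g free_algebra" where
  "free_scalar c = Poly_Mapping.single 0 c"

definition free_gen :: "'g \<Rightarrow> 'g free_algebra" where
  "free_gen g = Poly_Mapping.single (Word [g]) 1"

inductive_set two_sided_ideal :: "'a::ring_1 set \<Rightarrow> 'a set" for S :: "'a set" where
  zero: "0 \<in> two_sided_ideal S"
| gen: "s \<in> S \<Longrightarrow> s \<in> two_sided_ideal S"
| add: "a \<in> two_sided_ideal S \<Longrightarrow> b \<in> two_sided_ideal S \<Longrightarrow> a + b \<in> two_sided_ideal S"
| mult_left: "a \<in> two_sided_ideal S \<Longrightarrow> r * a \<in> two_sided_ideal S"
| mult_right: "a \<in> two_sided_ideal S \<Longrightarrow> a * r \<in> two_sided_ideal S"

lemma two_sided_ideal_uminus: "a \<in> two_sided_ideal S \<Longrightarrow> - a \<in> two_sided_ideal S"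
  using two_sided_ideal.mult_left[of a S "- 1"] by simp

lemma two_sided_ideal_diff:
  "a \<in> two_sided_ideal S \<Longrightarrow> b \<in> two_sided_ideal S \<Longrightarrow> a - b \<in> two_sided_ideal S"
  using two_sided_ideal.add[OF _ two_sided_ideal_uminus, of a S b] by simp


section \<open>Weyl algebras\<close>

text \<open>
  \<open>'i weyl\<close> is the complex Weyl algebra in the pairs of generators indexed by \<open>'i\<close>; the \<open>n\<close>-th
  Weyl algebra is obtained for an index type with \<open>n\<close> elements.
\<close>

datatype 'i weyl_gen = GenX 'i | GenD 'i

definition commutator :: "'a::ring \<Rightarrow> 'a \<Rightarrow> 'a" where
  "commutator a b = a * b - b * a"

definition weyl_relations :: "'i weyl_gen free_algebra set" where
  "weyl_relations =
     {commutator (free_gen (GenD i)) (free_gen (GenX j)) - (if i = j then 1 else 0) | i j. True}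
     \<union> {commutator (free_gen (GenX i)) (free_gen (GenX j)) | i j. True}
     \<union> {commutator (free_gen (GenD i)) (free_gen (GenD j)) | i j. True}"

definition weyl_rel :: "'i weyl_gen free_algebra \<Rightarrow> 'i weyl_gen free_algebra \<Rightarrow> bool" where
  "weyl_rel a b \<longleftrightarrow> a - b \<in> two_sided_ideal weyl_relations"

lemma equivp_weyl_rel: "equivp weyl_rel"
proof (rule equivpI)
  show "reflp weyl_rel"
    by (simp add: reflp_def weyl_rel_def two_sided_ideal.zero)
  show "symp weyl_rel"
    unfolding weyl_rel_def by (rule sympI) (drule two_sided_ideal_uminus, simp)
  show "transp weyl_rel"
    unfolding weyl_rel_def by (rule transpI) (drule (1) two_sided_ideal.add, simp)
qed

lemma weyl_rel_refl: "weyl_rel a a"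
  by (simp add: weyl_rel_def two_sided_ideal.zero)

quotient_type 'i weyl = "'i weyl_gen free_algebra" / weyl_rel
  by (rule equivp_weyl_rel)

text \<open>
  The class \<open>ring_1\<close> would also require \<open>0 \<noteq> 1\<close>, a theorem about Weyl algebras that is not needed
  to state anything below.
\<close>

instantiation weyl :: (type) "{ring, monoid_mult}"
begin

lift_definition zero_weyl :: "'a weyl" is 0 .

lift_definition one_weyl :: "'a weyl" is 1 .

lift_definition plus_weyl :: "'a weyl \<Rightarrow> 'a weyl \<Rightarrow> 'a weyl" is "(+)"
  unfolding weyl_rel_def by (drule (1) two_sided_ideal.add) (simp add: algebra_simps)

lift_definition uminus_weyl :: "'a weyl \<Rightarrow> 'a weyl" is uminus
  unfolding weyl_rel_def by (drule two_sided_ideal_uminus) simp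

lift_definition minus_weyl :: "'a weyl \<Rightarrow> 'a weyl \<Rightarrow> 'a weyl" is "(-)"
proof -
  fix a b c d :: "'a weyl_gen free_algebra"
  assume "weyl_rel a b" and "weyl_rel c d"
  moreover have "(a - c) - (b - d) = (a - b) - (c - d)"
    by (simp add: algebra_simps)
  ultimately show "weyl_rel (a - c) (b - d)"
    unfolding weyl_rel_def by (simp only: two_sided_ideal_diff)
qed

lift_definition times_weyl :: "'a weyl \<Rightarrow> 'a weyl \<Rightarrow> 'a weyl" is "(*)"
proof -
  fix a b c d :: "'a weyl_gen free_algebra"
  assume "weyl_rel a b" and "weyl_rel c d"
  moreover have "a * c - b * d = (a - b) * c + b * (c - d)"
    by (simp add: algebra_simps)
  ultimately show "weyl_rel (a * c) (b * d)"
    unfolding weyl_rel_def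
    by (simp only: two_sided_ideal.add two_sided_ideal.mult_left two_sided_ideal.mult_right)
qed

instance
proof
  fix a b c :: "'a weyl"
  show "a + b + c = a + (b + c)"
    by transfer (simp only: add.assoc weyl_rel_refl)
  show "a + b = b + a"
    by transfer (subst add.commute, rule weyl_rel_refl)
  show "0 + a = a"
    by transfer (simp only: add_0_left weyl_rel_refl)
  show "- a + a = 0"
    by transfer (simp only: left_minus weyl_rel_refl)
  show "a - b = a + - b"
    by transfer (simp only: diff_conv_add_uminus weyl_rel_refl)
  show "a * b * c = a * (b * c)"
    by transfer (simp only: mult.assoc weyl_rel_refl)
  show "(a + b) * c = a * c + b * c"
    by transfer (simp only: distrib_right weyl_rel_refl)
  show "a * (b + c) = a * b + a * c"
    by transfer (simp only: distrib_left weyl_rel_refl)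
  show "1 * a = a"
    by transfer (simp only: mult_1_left weyl_rel_refl)
  show "a * 1 = a"
    by transfer (simp only: mult_1_right weyl_rel_refl)
qed

end

lift_definition weyl_scale :: "complex \<Rightarrow> 'i weyl \<Rightarrow> 'i weyl" is "\<lambda>c a. free_scalar c * a"
  unfolding weyl_rel_def right_diff_distrib[symmetric] by (rule two_sided_ideal.mult_left)

lift_definition weyl_X :: "'i \<Rightarrow> 'i weyl" is "\<lambda>i. free_gen (GenX i)" .

lift_definition weyl_D :: "'i \<Rightarrow> 'i weyl" is "\<lambda>i. free_gen (GenD i)" .

lemma weyl_commutation_relations:
  "commutator (weyl_D i) (weyl_X j) = (if i = j then 1 else 0)"
  "commutator (weyl_X i) (weyl_X j) = 0"
  "commutator (weyl_D i) (weyl_D j) = 0"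
  unfolding commutator_def
  by (transfer, unfold weyl_rel_def weyl_relations_def commutator_def diff_0_right,
      rule two_sided_ideal.gen, blast)+

definition weyl_endomorphism :: "('i weyl \<Rightarrow> 'i weyl) \<Rightarrow> bool" where
  "weyl_endomorphism \<phi> \<longleftrightarrow>
     (\<forall>a b. \<phi> (a + b) = \<phi> a + \<phi> b) \<and>
     (\<forall>c a. \<phi> (weyl_scale c a) = weyl_scale c (\<phi> a)) \<and>
     (\<forall>a b. \<phi> (a * b) = \<phi> a * \<phi> b) \<and>
     \<phi> 1 = 1"

definition weyl_automorphism :: "('i weyl \<Rightarrow> 'i weyl) \<Rightarrow> bool" where
  "weyl_automorphism \<phi> \<longleftrightarrow> weyl_endomorphism \<phi> \<and> bij \<phi>"

text \<open>The Dixmier conjecture \<open>DC(n)\<close> is \<open>dixmier_conjecture TYPE('i)\<close> for \<open>'i\<close> with \<open>n\<close> elements.\<close>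

definition dixmier_conjecture :: "'i::finite itself \<Rightarrow> bool" where
  "dixmier_conjecture _ \<longleftrightarrow>
     (\<forall>\<phi> :: 'i weyl \<Rightarrow> 'i weyl. weyl_endomorphism \<phi> \<longrightarrow> weyl_automorphism \<phi>)"


section \<open>Polynomials in four variables\<close>

text \<open>
  The index type \<open>4\<close> has the elements \<open>1, 2, 3, 4\<close>, where \<open>4 = 0\<close>.  The exponent of a monomial is a
  finitely supported function \<open>4 \<Rightarrow>\<^sub>0 nat\<close>.
\<close>

type_synonym poly4 = "(4 \<Rightarrow>\<^sub>0 nat) \<Rightarrow>\<^sub>0 complex"

definition pol_const :: "complex \<Rightarrow> poly4" where
  "pol_const c = Poly_Mapping.single 0 c"

definition pol_var :: "4 \<Rightarrow> poly4" where
  "pol_var i = Poly_Mapping.single (Poly_Mapping.single i 1) 1"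

definition pol_deriv :: "4 \<Rightarrow> poly4 \<Rightarrow> poly4" where
  "pol_deriv i f =
     (\<Sum>m\<in>Poly_Mapping.keys f.
        Poly_Mapping.single (m - Poly_Mapping.single i 1)
          (of_nat (Poly_Mapping.lookup m i) * Poly_Mapping.lookup f m))"

definition mult_operator :: "poly4 \<Rightarrow> 4 weyl" where
  "mult_operator f =
     (\<Sum>m\<in>Poly_Mapping.keys f.
        weyl_scale (Poly_Mapping.lookup f m)
          (weyl_X 1 ^ Poly_Mapping.lookup m 1 * weyl_X 2 ^ Poly_Mapping.lookup m 2 *
           weyl_X 3 ^ Poly_Mapping.lookup m 3 * weyl_X 4 ^ Poly_Mapping.lookup m 4))"

text \<open>
  With \<open>(X\<^sub>1, X\<^sub>2, X\<^sub>3, X\<^sub>4) = (x, q, p, z)\<close>, this is the derivation \<open>g \<mapsto> {F, g}\<close> for the Poisson bracket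
  \<open>{f, g} = f\<^sub>p g\<^sub>x - f\<^sub>x g\<^sub>p + f\<^sub>z g\<^sub>q - f\<^sub>q g\<^sub>z\<close>, as an element of the Weyl algebra.
\<close>

definition hamiltonian :: "poly4 \<Rightarrow> 4 weyl" where
  "hamiltonian F =
     mult_operator (pol_deriv 3 F) * weyl_D 1 + mult_operator (pol_deriv 4 F) * weyl_D 2
     - mult_operator (pol_deriv 1 F) * weyl_D 3 - mult_operator (pol_deriv 2 F) * weyl_D 4"

definition pol_x :: poly4 where "pol_x = pol_var 1"
definition pol_q :: poly4 where "pol_q = pol_var 2"
definition pol_p :: poly4 where "pol_p = pol_var 3"
definition pol_z :: poly4 where "pol_z = pol_var 4"

definition pol_a :: poly4 where
  "pol_a = 1 - 3 * pol_x * pol_q"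

definition pol_B :: poly4 where
  "pol_B = 3 * pol_x^2 * pol_p + 2 * pol_a * pol_z"

definition pol_beta :: poly4 where
  "pol_beta = pol_B - 9 * pol_q^2"

definition pol_y :: poly4 where
  "pol_y = pol_q - pol_const (1/3) * pol_x * pol_beta"

definition pol_u :: poly4 where
  "pol_u = pol_x * pol_y"

definition pol_R :: poly4 where
  "pol_R = 2 * pol_x - 3 * pol_x^2 * pol_y - pol_x^3 * pol_beta"

definition pol_S :: poly4 where
  "pol_S = pol_y + 3 * pol_x * (1 + pol_u)^2 * pol_beta + 3 * pol_x * pol_y^2 * (4 + 3 * pol_u)"

definition pol_T :: poly4 where
  "pol_T = - pol_const (1/2) *
     ((1 + pol_u)^3 * pol_beta + pol_y^2 * (1 + pol_u) * (4 + 3 * pol_u))"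

definition pol_D0 :: poly4 where
  "pol_D0 = pol_const (1/2) * (1 + 3 * pol_x * pol_q) * pol_p - 3 * pol_q^2 * pol_z"

definition pol_H :: poly4 where
  "pol_H =
     pol_const (1/20) * pol_y^4 * (18 * pol_u^2 + 78 * pol_u + 125)
     + pol_const (3/10) * pol_beta * pol_y^2 * (pol_u^3 + 5 * pol_u^2 + 10 * pol_u - 5)
     - pol_const (1/6) * pol_beta^2 * (9 * pol_u + 2)
     - pol_const (1/6) * pol_x^2 * pol_beta^3"

definition pol_D :: poly4 where
  "pol_D = pol_D0 + pol_H"

definition extends_assignment :: "(4 weyl \<Rightarrow> 4 weyl) \<Rightarrow> bool" where
  "extends_assignment \<Phi> \<longleftrightarrow>
     \<Phi> (weyl_X 1) = mult_operator pol_R \<and> \<Phi> (weyl_D 1) = hamiltonian pol_D \<and>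
     \<Phi> (weyl_X 2) = mult_operator pol_T \<and> \<Phi> (weyl_D 2) = hamiltonian pol_S \<and>
     \<Phi> (weyl_X 3) = mult_operator pol_D \<and> \<Phi> (weyl_D 3) = - hamiltonian pol_R \<and>
     \<Phi> (weyl_X 4) = mult_operator pol_S \<and> \<Phi> (weyl_D 4) = - hamiltonian pol_T"

end

(*
  The Hamiltonian derivations of a polynomial map whose components have canonical Poisson brackets
  satisfy the Weyl relations, so the universal property yields the endomorphism. The six brackets
  reduce to polynomial identities in x, y, beta, since these three generate a Poisson subalgebra
  which is stable under {D0, _}. The images of the generators act on C[R,T,D,S]
  as multiplications by R, T, D, S and as the partial derivatives in these elements, so this
  subalgebra is stable under every operator in the image of the endomorphism. If multiplication
  by x were in the image, then applying it to 1 would show that x is a polynomial in R, T, D, S;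
  but these four take the same values at (1, 2/3, 7/2, 0) and (-1, -2/3, 7/2, 0).
*)

theory Submission
  imports Defs "HOL-Analysis.Cartesian_Space"
begin

section \<open>Evaluation of monoid algebras\<close>

lemma poly_mapping_eq_sum_single:
  fixes f :: "'k \<Rightarrow>\<^sub>0 'v::comm_monoid_add"
  shows "f = (\<Sum>k\<in>Poly_Mapping.keys f. Poly_Mapping.single k (Poly_Mapping.lookup f k))"
  by (rule poly_mapping_eqI)
    (simp add: lookup_sum lookup_single when_def in_keys_iff)

lemma poly_mapping_single_add_induct [case_names single add]:
  fixes f :: "'k \<Rightarrow>\<^sub>0 'v::comm_monoid_add"
  assumes single: "\<And>k v. P (Poly_Mapping.single k v)"
    and add: "\<And>f g. P f \<Longrightarrow> P g \<Longrightarrow> P (f + g)"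
  shows "P f"
proof -
  have "P (\<Sum>k\<in>K. Poly_Mapping.single k (Poly_Mapping.lookup f k))" if "finite K" for K
    using that
  proof induction
    case empty
    \<comment> \<open>The zero mapping is a single term with coefficient 0, at an arbitrary
      key.\<close>
    show ?case using single[of undefined 0] by simp
  next
    case (insert k K)
    then show ?case by (simp add: add single)
  qed
  then show ?thesis
    by (subst poly_mapping_eq_sum_single) simp
qed

text \<open>A complex algebra structure, encoded as a unital ring homomorphism from the complex
  numbers into the centre. The sort is \<open>{ring, monoid_mult}\<close> because
  \<open>weyl\<close> is not an instance of \<open>ring_1\<close>, which demands
  \<open>0 \<noteq> 1\<close>.\<close>

locale central_scalars =
  fixes scalar :: "complex \<Rightarrow> 'r::{ring, monoid_mult}"
  assumes scalar_add: "scalar (c + d) = scalar c + scalar d"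
    and scalar_mult: "scalar (c * d) = scalar c * scalar d"
    and scalar_one: "scalar 1 = 1"
    and scalar_central: "scalar c * r = r * scalar c"
begin

lemma scalar_zero: "scalar 0 = 0"
  using scalar_add[of 0 0] by simp

end

text \<open>The universal property of a monoid algebra: a monoid homomorphism into the
  multiplicative monoid of an algebra extends linearly to an algebra homomorphism. It serves for
  words in the free algebra, for values of polynomials at points and for multiplication
  operators.\<close>

locale monoid_algebra_eval = central_scalars scalar
  for scalar :: "complex \<Rightarrow> 'r::{ring, monoid_mult}" +
  fixes char :: "'m::monoid_add \<Rightarrow> 'r"
  assumes char_zero: "char 0 = 1"
    and char_add: "char (m + n) = char m * char n"
begin

definition eval :: "('m \<Rightarrow>\<^sub>0 complex) \<Rightarrow> 'r" where
  "eval f = (\<Sum>m\<in>Poly_Mapping.keys f. scalar (Poly_Mapping.lookup f m) * char m)"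

text \<open>Keys outside the support contribute \<open>scalar 0 = 0\<close>. A common finite index
  set makes the evaluations of \<open>f\<close>, \<open>g\<close> and \<open>f + g\<close>
  comparable.\<close>

lemma eval_superset:
  assumes "finite K" "Poly_Mapping.keys f \<subseteq> K"
  shows "eval f = (\<Sum>m\<in>K. scalar (Poly_Mapping.lookup f m) * char m)"
  unfolding eval_def
  by (rule sum.mono_neutral_left) (use assms in \<open>auto simp: in_keys_iff scalar_zero\<close>)

lemma eval_single: "eval (Poly_Mapping.single m c) = scalar c * char m"
  by (subst eval_superset[of "{m}"]) auto

lemma eval_add: "eval (f + g) = eval f + eval g"
proof -
  let ?K = "Poly_Mapping.keys f \<union> Poly_Mapping.keys g"
  have "Poly_Mapping.keys (f + g) \<subseteq> ?K" by (rule keys_add)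
  then show ?thesis
    by (subst (1 2 3) eval_superset[of ?K])
      (auto simp: lookup_add scalar_add distrib_right sum.distrib)
qed

lemma eval_one: "eval 1 = 1"
  by (simp add: eval_single char_zero scalar_one flip: single_one)

text \<open>Both sides are additive in each factor, so single terms suffice; there centrality moves
  the second scalar past the first character value.\<close>

lemma eval_mult: "eval (f * g) = eval f * eval g"
proof (induction f rule: poly_mapping_single_add_induct)
  case (single k v)
  show ?case
  proof (induction g rule: poly_mapping_single_add_induct)
    case (single l w)
    have "scalar v * scalar w * (char k * char l) = scalar v * char k * (scalar w * char l)"
      by (metis mult.assoc scalar_central)
    then show ?case
      by (simp add: mult_single eval_single scalar_mult char_add)
  next
    case (add f g)
    then show ?case by (simp add: distrib_left eval_add)
  qed
next
  case (add f g)
  then show ?case by (simp add: distrib_right eval_add)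
qed

lemma eval_zero: "eval 0 = 0"
  by (simp add: eval_def)

lemma eval_uminus: "eval (- f) = - eval f"
  using eval_add[of f "- f"] by (simp add: eval_zero eq_neg_iff_add_eq_0 add.commute)

lemma eval_diff: "eval (f - g) = eval f - eval g"
  using eval_add[of f "- g"] by (simp add: eval_uminus)

lemma eval_power: "eval (f ^ n) = eval f ^ n"
  by (induction n) (simp_all add: eval_one eval_mult)

end


section \<open>The universal property of the Weyl algebra\<close>

lemma weyl_scale_one_mult: "weyl_scale c 1 * w = weyl_scale c w"
  by transfer (simp add: mult.assoc weyl_rel_refl)

interpretation weyl: central_scalars "\<lambda>c. weyl_scale c (1 :: 'i weyl)"
proof
  fix c d and r :: "'i weyl"
  show "weyl_scale (c + d) 1 = weyl_scale c 1 + weyl_scale d (1 :: 'i weyl)"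
    by transfer (simp add: free_scalar_def single_add weyl_rel_refl)
  show "weyl_scale (c * d) 1 = weyl_scale c 1 * weyl_scale d (1 :: 'i weyl)"
    by transfer (simp add: free_scalar_def mult_single weyl_rel_refl)
  show "weyl_scale 1 1 = (1 :: 'i weyl)"
    by transfer (simp add: free_scalar_def weyl_rel_refl)
  show "weyl_scale c 1 * r = r * weyl_scale c 1"
  proof transfer
    fix c and r :: "'i weyl_gen free_algebra"
    \<comment> \<open>A scalar is supported on the empty word, which is neutral for concatenation on
      both sides.\<close>
    have "free_scalar c * r = r * free_scalar c"
    proof (induction r rule: poly_mapping_single_add_induct)
      case (single k v)
      then show ?case by (simp add: free_scalar_def mult_single mult.commute)
    next
      case (add f g)
      then show ?case by (simp add: distrib_left distrib_right)
    qed
    then show "weyl_rel (free_scalar c * 1 * r) (r * (free_scalar c * 1))"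
      by (simp add: weyl_rel_refl)
  qed
qed

lemma free_single_word:
  "Poly_Mapping.single (Word ws) c = free_scalar c * prod_list (map free_gen ws)"
proof (induction ws arbitrary: c)
  case Nil
  then show ?case by (simp add: free_scalar_def zero_free_monoid_def)
next
  case (Cons g ws)
  have "Poly_Mapping.single (Word (g # ws)) c
      = free_gen g * Poly_Mapping.single (Word ws) c"
    by (simp add: free_gen_def mult_single plus_free_monoid_def)
  also have "\<dots> = free_scalar c * (free_gen g * prod_list (map free_gen ws))"
  proof -
    have "free_gen g * free_scalar c = free_scalar c * free_gen g"
      by (simp add: free_scalar_def free_gen_def mult_single)
    then show ?thesis by (simp add: Cons flip: mult.assoc)
  qed
  finally show ?case by simp
qed

text \<open>Every element is the class of a sum of scalar multiples of words, so scalars and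
  generators produce the whole algebra under sums and products.\<close>

lemma weyl_induct [case_names scalar X D add mult]:
  fixes w :: "'i weyl"
  assumes scalar: "\<And>c. P (weyl_scale c 1)"
    and X: "\<And>i. P (weyl_X i)"
    and D: "\<And>i. P (weyl_D i)"
    and add: "\<And>v w. P v \<Longrightarrow> P w \<Longrightarrow> P (v + w)"
    and mult: "\<And>v w. P v \<Longrightarrow> P w \<Longrightarrow> P (v * w)"
  shows "P w"
proof (induction w rule: weyl.abs_induct)
  case (1 f)
  have scalar': "P (abs_weyl (free_scalar c))" for c
    using scalar[of c] by (simp add: weyl_scale.abs_eq one_weyl_def)
  have gen: "P (abs_weyl (free_gen g))" for g
    by (cases g) (use X D in \<open>simp_all add: weyl_X.abs_eq weyl_D.abs_eq\<close>)
  have word: "P (abs_weyl (prod_list (map free_gen ws)))" for ws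
  proof (induction ws)
    case Nil
    show ?case using scalar'[of 1] by (simp add: free_scalar_def)
  next
    case (Cons g ws)
    then show ?case using mult[OF gen[of g] Cons] by (simp add: times_weyl.abs_eq)
  qed
  show ?case
  proof (induction f rule: poly_mapping_single_add_induct)
    case (single k v)
    show ?case
      using mult[OF scalar' word, of v "letters k"] free_single_word[of "letters k" v]
      by (simp add: times_weyl.abs_eq)
  next
    case (add f g)
    then show ?case using assms(4) by (simp flip: plus_weyl.abs_eq)
  qed
qed

text \<open>Elements of an algebra that satisfy the Weyl relations. The resulting homomorphism
  \<open>lift\<close> is used twice: for the action on polynomials and for the endomorphism
  itself.\<close>

locale weyl_representation = central_scalars scalar
  for scalar :: "complex \<Rightarrow> 'r::{ring, monoid_mult}" +
  fixes X D :: "'i \<Rightarrow> 'r"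
  assumes DX: "commutator (D i) (X j) = (if i = j then 1 else 0)"
    and XX: "commutator (X i) (X j) = 0"
    and DD: "commutator (D i) (D j) = 0"
begin

fun gen_image :: "'i weyl_gen \<Rightarrow> 'r" where
  "gen_image (GenX i) = X i"
| "gen_image (GenD i) = D i"

sublocale free: monoid_algebra_eval scalar "\<lambda>w. prod_list (map gen_image (letters w))"
  by standard (simp_all add: zero_free_monoid_def plus_free_monoid_def)

lemma eval_free_gen: "free.eval (free_gen g) = gen_image g"
  by (simp add: free_gen_def free.eval_single scalar_one)

lemma eval_free_scalar: "free.eval (free_scalar c) = scalar c"
  by (simp add: free_scalar_def free.eval_single zero_free_monoid_def)

text \<open>The kernel of a homomorphism is a two-sided ideal, so only the defining relations have
  to be checked, and these are the locale assumptions.\<close>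

lemma eval_weyl_ideal: "f \<in> two_sided_ideal weyl_relations \<Longrightarrow> free.eval f = 0"
proof (induction rule: two_sided_ideal.induct)
  case (gen s)
  then show ?case
    using DX XX DD
    by (auto simp: weyl_relations_def commutator_def free.eval_diff free.eval_mult
        free.eval_one free.eval_zero eval_free_gen)
qed (simp_all add: free.eval_zero free.eval_add free.eval_mult)

lemma eval_weyl_rel: "weyl_rel f g \<Longrightarrow> free.eval f = free.eval g"
  using eval_weyl_ideal[of "f - g"] by (simp add: weyl_rel_def free.eval_diff)

definition lift :: "'i weyl \<Rightarrow> 'r" where
  "lift w = free.eval (rep_weyl w)"

text \<open>The representative chosen by \<open>rep_weyl\<close> is irrelevant, since equivalent
  elements have equal evaluations. All laws for \<open>lift\<close> follow from this form.\<close>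

lemma lift_abs: "lift (abs_weyl f) = free.eval f"
  unfolding lift_def
  by (rule eval_weyl_rel) (rule Quotient3_rep_abs[OF Quotient3_weyl weyl_rel_refl])

lemma lift_add: "lift (v + w) = lift v + lift w"
  by (induction v rule: weyl.abs_induct, induction w rule: weyl.abs_induct)
    (simp add: plus_weyl.abs_eq lift_abs free.eval_add)

lemma lift_mult: "lift (v * w) = lift v * lift w"
  by (induction v rule: weyl.abs_induct, induction w rule: weyl.abs_induct)
    (simp add: times_weyl.abs_eq lift_abs free.eval_mult)

lemma lift_one: "lift 1 = 1"
  by (simp add: one_weyl_def lift_abs free.eval_one)

lemma lift_scale: "lift (weyl_scale c w) = scalar c * lift w"
  by (induction w rule: weyl.abs_induct)
    (simp add: weyl_scale.abs_eq lift_abs free.eval_mult eval_free_scalar)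

lemma lift_X: "lift (weyl_X i) = X i"
  by (simp add: weyl_X.abs_eq lift_abs eval_free_gen)

lemma lift_D: "lift (weyl_D i) = D i"
  by (simp add: weyl_D.abs_eq lift_abs eval_free_gen)

end

section \<open>Polynomials\<close>

lemma pol_const_add: "pol_const (c + d) = pol_const c + pol_const d"
  by (simp add: pol_const_def single_add)

lemma pol_const_mult: "pol_const (c * d) = pol_const c * pol_const d"
  by (simp add: pol_const_def mult_single)

lemma pol_const_one: "pol_const 1 = 1"
  by (simp add: pol_const_def)

lemma pol_const_numeral: "pol_const (numeral n) = numeral n"
  by (simp add: pol_const_def)

lemma pol_const_uminus: "pol_const (- c) = - pol_const c"
  by (simp add: pol_const_def single_uminus)

lemma pol_var_power: "pol_var i ^ n = Poly_Mapping.single (Poly_Mapping.single i n) 1"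
  by (induction n) (simp_all add: pol_var_def mult_single flip: single_add)

lemma exponent_eq_sum:
  fixes m :: "4 \<Rightarrow>\<^sub>0 nat"
  shows "m = Poly_Mapping.single 1 (Poly_Mapping.lookup m 1)
      + Poly_Mapping.single 2 (Poly_Mapping.lookup m 2)
    + Poly_Mapping.single 3 (Poly_Mapping.lookup m 3)
        + Poly_Mapping.single 4 (Poly_Mapping.lookup m 4)"
proof -
  have "m = (\<Sum>i\<in>UNIV. Poly_Mapping.single i (Poly_Mapping.lookup m i))"
    by (rule poly_mapping_eqI) (simp add: lookup_sum lookup_single when_def)
  then show ?thesis by (simp only: sum_4)
qed

lemma pol_single_eq:
  "Poly_Mapping.single m c = pol_const c *
     (pol_var 1 ^ Poly_Mapping.lookup m 1 * pol_var 2 ^ Poly_Mapping.lookup m 2 *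
      pol_var 3 ^ Poly_Mapping.lookup m 3 * pol_var 4 ^ Poly_Mapping.lookup m 4)"
  by (subst exponent_eq_sum) (simp add: pol_var_power pol_const_def mult_single)

lemma poly4_induct [case_names const var add mult]:
  fixes f :: poly4
  assumes const: "\<And>c. P (pol_const c)"
    and var: "\<And>i. P (pol_var i)"
    and add: "\<And>f g. P f \<Longrightarrow> P g \<Longrightarrow> P (f + g)"
    and mult: "\<And>f g. P f \<Longrightarrow> P g \<Longrightarrow> P (f * g)"
  shows "P f"
proof (induction f rule: poly_mapping_single_add_induct)
  case (single m c)
  have "P (pol_var i ^ n)" for i n
  proof (induction n)
    case 0
    show ?case using const[of 1] by (simp add: pol_const_one)
  qed (simp add: var mult)
  then show ?case by (simp add: pol_single_eq const mult)
qed (rule add)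

section \<open>Partial derivatives\<close>

lemma pol_deriv_superset:
  assumes "finite K" "Poly_Mapping.keys f \<subseteq> K"
  shows "pol_deriv i f = (\<Sum>m\<in>K. Poly_Mapping.single (m - Poly_Mapping.single i 1)
          (of_nat (Poly_Mapping.lookup m i) * Poly_Mapping.lookup f m))"
  unfolding pol_deriv_def
  by (rule sum.mono_neutral_left) (use assms in \<open>auto simp: in_keys_iff\<close>)

lemma pol_deriv_single:
  "pol_deriv i (Poly_Mapping.single m c) =
     Poly_Mapping.single (m - Poly_Mapping.single i 1) (of_nat (Poly_Mapping.lookup m i) * c)"
  by (subst pol_deriv_superset[of "{m}"]) auto

lemma pol_deriv_add: "pol_deriv i (f + g) = pol_deriv i f + pol_deriv i g"
proof -
  let ?K = "Poly_Mapping.keys f \<union> Poly_Mapping.keys g"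
  have "Poly_Mapping.keys (f + g) \<subseteq> ?K" by (rule keys_add)
  then show ?thesis
    by (subst (1 2 3) pol_deriv_superset[of ?K])
      (auto simp: lookup_add distrib_left single_add sum.distrib)
qed

text \<open>Subtraction of exponents is truncated, hence the hypothesis that variable
  \<open>i\<close> occurs in \<open>m\<close>.\<close>

lemma exponent_add_diff_single:
  fixes m n :: "4 \<Rightarrow>\<^sub>0 nat"
  assumes "Poly_Mapping.lookup m i \<noteq> 0"
  shows "m + n - Poly_Mapping.single i (Suc 0) = m - Poly_Mapping.single i (Suc 0) + n"
  by (rule poly_mapping_eqI)
    (use assms in \<open>auto simp: lookup_add lookup_minus lookup_single when_def\<close>)

lemma pol_deriv_mult: "pol_deriv i (f * g) = pol_deriv i f * g + f * pol_deriv i g"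
proof (induction f rule: poly_mapping_single_add_induct)
  case (single m c)
  show ?case
  proof (induction g rule: poly_mapping_single_add_induct)
    case (single n d)
    \<comment> \<open>If variable \<open>i\<close> does not occur in \<open>m\<close>, the exponents
      may differ, but the coefficient is 0 on both sides.\<close>
    have l: "Poly_Mapping.single (m + n
        - Poly_Mapping.single i 1) (of_nat (Poly_Mapping.lookup m i) * c * d)
        = Poly_Mapping.single (m - Poly_Mapping.single i 1
            + n) (of_nat (Poly_Mapping.lookup m i) * c * d)"
      by (cases "Poly_Mapping.lookup m i = 0") (simp_all add: exponent_add_diff_single)
    have r: "Poly_Mapping.single (m + n
        - Poly_Mapping.single i 1) (of_nat (Poly_Mapping.lookup n i) * c * d)
        = Poly_Mapping.single (m + (n
            - Poly_Mapping.single i 1)) (of_nat (Poly_Mapping.lookup n i) * c * d)"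
      by (cases "Poly_Mapping.lookup n i = 0")
        (simp_all add: exponent_add_diff_single add.commute[of m])
    have "pol_deriv i (Poly_Mapping.single m c * Poly_Mapping.single n d)
        = Poly_Mapping.single (m + n
            - Poly_Mapping.single i 1) (of_nat (Poly_Mapping.lookup m i) * c * d)
        + Poly_Mapping.single (m + n
            - Poly_Mapping.single i 1) (of_nat (Poly_Mapping.lookup n i) * c * d)"
      by (simp add: mult_single pol_deriv_single lookup_add algebra_simps flip: single_add)
    then show ?case
      unfolding l r by (simp add: mult_single pol_deriv_single ac_simps)
  next
    case (add f g)
    then show ?case by (simp add: distrib_left pol_deriv_add)
  qed
next
  case (add f g)
  then show ?case by (simp add: distrib_right pol_deriv_add)
qed

lemma pol_deriv_const: "pol_deriv i (pol_const c) = 0"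
  by (simp add: pol_const_def pol_deriv_single)

lemma pol_deriv_var: "pol_deriv i (pol_var j) = (if i = j then 1 else 0)"
  by (simp add: pol_var_def pol_deriv_single lookup_single)

lemma pol_deriv_zero: "pol_deriv i 0 = 0"
  by (simp add: pol_deriv_def)

lemma pol_deriv_one: "pol_deriv i 1 = 0"
  using pol_deriv_const[of i 1] by (simp add: pol_const_one)

lemma pol_deriv_numeral: "pol_deriv i (numeral n) = 0"
  using pol_deriv_const[of i "numeral n"] by (simp add: pol_const_numeral)

lemma pol_deriv_uminus: "pol_deriv i (- f) = - pol_deriv i f"
  using pol_deriv_add[of i f "- f"] by (simp add: pol_deriv_zero eq_neg_iff_add_eq_0 add.commute)

lemma pol_deriv_diff: "pol_deriv i (f - g) = pol_deriv i f - pol_deriv i g"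
  using pol_deriv_add[of i f "- g"] by (simp add: pol_deriv_uminus)

lemma pol_deriv_commute: "pol_deriv i (pol_deriv j f) = pol_deriv j (pol_deriv i f)"
  by (induction f rule: poly4_induct)
    (simp_all add: pol_deriv_const pol_deriv_var pol_deriv_zero pol_deriv_one
      pol_deriv_add pol_deriv_mult)

interpretation pol: central_scalars pol_const
  by standard (simp_all add: pol_const_add pol_const_mult pol_const_one)

section \<open>Values of polynomials at points\<close>

definition point_monomial :: "(4 \<Rightarrow> complex) \<Rightarrow> (4 \<Rightarrow>\<^sub>0 nat) \<Rightarrow> complex" where
  "point_monomial v m = (\<Prod>i\<in>UNIV. v i ^ Poly_Mapping.lookup m i)"

interpretation pol_at: monoid_algebra_eval "\<lambda>c. c" "point_monomial v" for v
  by standard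
    (simp_all add: point_monomial_def lookup_add power_add prod.distrib algebra_simps)

lemma pol_at_const: "pol_at.eval v (pol_const c) = c"
  by (simp add: pol_const_def pol_at.eval_single pol_at.char_zero)

lemma pol_at_numeral: "pol_at.eval v (numeral n) = numeral n"
  using pol_at_const[of v "numeral n"] by (simp add: pol_const_numeral)

lemma pol_at_var: "pol_at.eval v (pol_var i) = v i"
proof -
  have "(\<Prod>j\<in>UNIV. v j ^ Poly_Mapping.lookup (Poly_Mapping.single i (Suc 0)) j)
      = (\<Prod>j\<in>UNIV. if j = i then v j else 1)"
    by (intro prod.cong) (auto simp: lookup_single when_def)
  then show ?thesis
    by (simp add: pol_var_def pol_at.eval_single point_monomial_def)
qed


section \<open>Multiplication operators and Hamiltonian derivations\<close>

abbreviation weyl_monomial :: "(4 \<Rightarrow>\<^sub>0 nat) \<Rightarrow> 4 weyl" where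
  "weyl_monomial m \<equiv> weyl_X 1 ^ Poly_Mapping.lookup m 1 * weyl_X 2 ^ Poly_Mapping.lookup m 2 *
     weyl_X 3 ^ Poly_Mapping.lookup m 3 * weyl_X 4 ^ Poly_Mapping.lookup m 4"

lemma weyl_X_commute: "weyl_X i * weyl_X j = weyl_X j * weyl_X i"
  using weyl_commutation_relations(2)[of i j] by (simp add: commutator_def)

lemma weyl_X_power_commute: "weyl_X i ^ m * weyl_X j ^ n = weyl_X j ^ n * weyl_X i ^ m"
  by (metis power_commuting_commutes weyl_X_commute)

lemma mult_left_commute_of_commute:
  fixes a b c :: "'a::semigroup_mult"
  shows "a * b = b * a \<Longrightarrow> a * (b * c) = b * (a * c)"
  by (simp flip: mult.assoc)

text \<open>The powers can be sorted because the \<open>weyl_X i\<close> commute pairwise. As the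
  ring is not commutative, the six exchanges involved are assumed explicitly for eight arbitrary
  elements.\<close>

lemma weyl_monomial_add: "weyl_monomial (m + n) = weyl_monomial m * weyl_monomial n"
proof -
  have "(a1 * b1) * (a2 * b2) * (a3 * b3) * (a4 * b4) = (a1 * a2 * a3 * a4) * (b1 * b2 * b3 * b4)"
    if "b1 * a2 = a2 * b1" "b1 * a3 = a3 * b1" "b1 * a4 = a4 * b1"
      "b2 * a3 = a3 * b2" "b2 * a4 = a4 * b2" "b3 * a4 = a4 * b3"
    for a1 a2 a3 a4 b1 b2 b3 b4 :: "4 weyl"
    by (simp add: mult.assoc that that[THEN mult_left_commute_of_commute])
  then show ?thesis
    by (simp add: lookup_add power_add weyl_X_power_commute)
qed

interpretation mult_op: monoid_algebra_eval "\<lambda>c. weyl_scale c 1" weyl_monomial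
  by standard (simp, rule weyl_monomial_add)

text \<open>The two sums agree once scaling is written as multiplication by
  \<open>weyl_scale c 1\<close>. Hence \<open>mult_operator\<close> inherits the laws of an algebra
  homomorphism.\<close>

lemma mult_operator_eq_eval: "mult_operator = mult_op.eval"
  by (simp add: fun_eq_iff mult_operator_def mult_op.eval_def weyl_scale_one_mult)

lemmas mult_operator_add = mult_op.eval_add[folded mult_operator_eq_eval]
  and mult_operator_mult = mult_op.eval_mult[folded mult_operator_eq_eval]
  and mult_operator_zero = mult_op.eval_zero[folded mult_operator_eq_eval]
  and mult_operator_one = mult_op.eval_one[folded mult_operator_eq_eval]
  and mult_operator_uminus = mult_op.eval_uminus[folded mult_operator_eq_eval]
  and mult_operator_diff = mult_op.eval_diff[folded mult_operator_eq_eval]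

lemma mult_operator_const: "mult_operator (pol_const c) = weyl_scale c 1"
  by (simp add: mult_operator_eq_eval pol_const_def mult_op.eval_single)

lemma mult_operator_var: "mult_operator (pol_var i) = weyl_X i"
proof -
  have "i = 1 \<or> i = 2 \<or> i = 3 \<or> i = 4" by (rule exhaust_4)
  then show ?thesis
    by (auto simp: mult_operator_eq_eval pol_var_def mult_op.eval_single lookup_single
        weyl.scalar_one)
qed

lemma mult_operator_commute: "mult_operator f * mult_operator g = mult_operator g * mult_operator f"
  by (metis mult.commute mult_operator_mult)

lemma mult_operator_sum: "mult_operator (\<Sum>i\<in>I. f i) = (\<Sum>i\<in>I. mult_operator (f i))"
  by (induction I rule: infinite_finite_induct)
    (simp_all add: mult_operator_zero mult_operator_add)

text \<open>The commutator with \<open>weyl_D i\<close> and the derivative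
  \<open>pol_deriv i\<close> both obey the Leibniz rule, so agreement on constants and variables is
  enough.\<close>

lemma weyl_D_mult_operator:
  "weyl_D i * mult_operator f = mult_operator f * weyl_D i + mult_operator (pol_deriv i f)"
proof (induction f rule: poly4_induct)
  case (const c)
  show ?case
    by (simp add: mult_operator_const pol_deriv_const mult_operator_zero weyl.scalar_central)
next
  case (var j)
  show ?case
    using weyl_commutation_relations(1)[of i j]
    by (auto simp: mult_operator_var pol_deriv_var mult_operator_zero mult_operator_one
        commutator_def algebra_simps split: if_splits)
next
  case (add f g)
  then show ?case
    by (simp add: mult_operator_add pol_deriv_add distrib_left distrib_right)
next
  case (mult f g)
  have "weyl_D i * mult_operator (f * g) = (weyl_D i * mult_operator f) * mult_operator g"
    by (simp add: mult_operator_mult mult.assoc)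
  also have "\<dots> = mult_operator f * (weyl_D i * mult_operator g)
      + mult_operator (pol_deriv i f) * mult_operator g"
    by (simp add: mult(1) distrib_right mult.assoc)
  finally show ?case
    by (simp add: mult(2) mult_operator_mult mult_operator_add pol_deriv_mult distrib_left
        mult.assoc add.assoc add.commute)
qed

section \<open>The Poisson bracket and commutators of Hamiltonian derivations\<close>

definition poisson :: "poly4 \<Rightarrow> poly4 \<Rightarrow> poly4" where
  "poisson f g = pol_deriv 3 f * pol_deriv 1 g - pol_deriv 1 f * pol_deriv 3 g
     + pol_deriv 4 f * pol_deriv 2 g - pol_deriv 2 f * pol_deriv 4 g"

text \<open>The components of the Hamiltonian vector field, indexed so that brackets and commutators
  become sums over \<open>UNIV\<close> rather than four separate terms.\<close>

definition hamilton_coeff :: "4 \<Rightarrow> poly4 \<Rightarrow> poly4" where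
  "hamilton_coeff i f =
     (if i = 1 then pol_deriv 3 f else if i = 2 then pol_deriv 4 f
      else if i = 3 then - pol_deriv 1 f else - pol_deriv 2 f)"

lemma hamiltonian_eq_sum:
  "hamiltonian f = (\<Sum>i\<in>UNIV. mult_operator (hamilton_coeff i f) * weyl_D i)"
  by (simp add: hamiltonian_def hamilton_coeff_def sum_4 mult_operator_uminus)

lemma poisson_eq_sum: "poisson f g = (\<Sum>i\<in>UNIV. hamilton_coeff i f * pol_deriv i g)"
  by (simp add: poisson_def hamilton_coeff_def sum_4)

lemma poisson_anticommute: "poisson g f = - poisson f g"
  by (simp add: poisson_def algebra_simps)

text \<open>The Jacobi identity in components: it follows from the Leibniz rule and the symmetry of
  second partial derivatives.\<close>

lemma hamilton_coeff_poisson: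
  "hamilton_coeff i (poisson f g) = poisson f (hamilton_coeff i g) - poisson g (hamilton_coeff i f)"
  by (simp add: poisson_def hamilton_coeff_def pol_deriv_add pol_deriv_diff pol_deriv_mult
      pol_deriv_uminus pol_deriv_commute[of 2 1] pol_deriv_commute[of 3 1] pol_deriv_commute[of 4 1]
      pol_deriv_commute[of 3 2] pol_deriv_commute[of 4 2] pol_deriv_commute[of 4 3] algebra_simps)

lemma commutator_add_left: "commutator (a + b) c = commutator a c + commutator b c"
  by (simp add: commutator_def algebra_simps)

lemma commutator_zero_left: "commutator 0 c = 0"
  by (simp add: commutator_def)

lemma commutator_sum_left: "commutator (\<Sum>i\<in>I. f i) c = (\<Sum>i\<in>I. commutator (f i) c)"
  by (induction I rule: infinite_finite_induct) (simp_all add: commutator_add_left commutator_zero_left)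

lemma commutator_anticommute: "commutator b a = - commutator a b"
  by (simp add: commutator_def)

lemma commutator_sum_right:
  "commutator c (\<Sum>i\<in>I. f i) = (\<Sum>i\<in>I. commutator c (f i))"
  by (subst commutator_anticommute)
    (simp add: commutator_sum_left commutator_anticommute[of c] sum_negf)

lemma commutator_vector_field_mult_operator:
  "commutator (mult_operator f * weyl_D i) (mult_operator g) = mult_operator (f * pol_deriv i g)"
proof -
  have "mult_operator f * weyl_D i * mult_operator g
      = mult_operator f * mult_operator g * weyl_D i
          + mult_operator f * mult_operator (pol_deriv i g)"
    by (simp add: mult.assoc weyl_D_mult_operator distrib_left)
  moreover have "mult_operator g * (mult_operator f * weyl_D i)
      = mult_operator f * mult_operator g * weyl_D i"
    by (metis mult.assoc mult_operator_commute)
  ultimately show ?thesis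
    by (simp add: commutator_def mult_operator_mult)
qed

lemma commutator_hamiltonian_mult_operator:
  "commutator (hamiltonian f) (mult_operator g) = mult_operator (poisson f g)"
  by (simp add: hamiltonian_eq_sum poisson_eq_sum commutator_sum_left mult_operator_sum
      commutator_vector_field_mult_operator)

text \<open>Moving derivatives to the right leaves a second-order term that is symmetric in the two
  fields and cancels; only first-order terms survive.\<close>

lemma commutator_vector_fields:
  "commutator (mult_operator f * weyl_D i) (mult_operator g * weyl_D j)
     = mult_operator (f * pol_deriv i g) * weyl_D j - mult_operator (g * pol_deriv j f) * weyl_D i"
proof -
  have expand: "mult_operator f * weyl_D i * (mult_operator g * weyl_D j)
      = mult_operator (f * g) * (weyl_D i * weyl_D j)
          + mult_operator (f * pol_deriv i g) * weyl_D j"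
    for f g :: poly4 and i j
  proof -
    have "mult_operator f * weyl_D i * (mult_operator g * weyl_D j)
        = mult_operator f * (weyl_D i * mult_operator g) * weyl_D j"
      by (simp add: mult.assoc)
    then show ?thesis
      by (simp add: weyl_D_mult_operator mult_operator_mult distrib_left distrib_right mult.assoc)
  qed
  have "weyl_D i * weyl_D j = weyl_D j * weyl_D i"
    using weyl_commutation_relations(3)[of i j] by (simp add: commutator_def)
  then show ?thesis
    by (simp add: commutator_def expand mult.commute[of g f])
qed

text \<open>Collecting the double sums by the derivative on the right gives exactly the components
  in \<open>hamilton_coeff_poisson\<close>, so \<open>hamiltonian\<close> is a homomorphism of Lie
  algebras.\<close>

lemma commutator_hamiltonian:
  "commutator (hamiltonian f) (hamiltonian g) = hamiltonian (poisson f g)"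
proof -
  have "commutator (hamiltonian f) (hamiltonian g)
      = (\<Sum>i\<in>UNIV. \<Sum>j\<in>UNIV.
          mult_operator (hamilton_coeff i f * pol_deriv i (hamilton_coeff j g)) * weyl_D j)
      - (\<Sum>i\<in>UNIV. \<Sum>j\<in>UNIV.
          mult_operator (hamilton_coeff j g * pol_deriv j (hamilton_coeff i f)) * weyl_D i)"
    unfolding hamiltonian_eq_sum commutator_sum_left
    by (simp add: commutator_sum_right commutator_vector_fields sum_subtractf)
  also have "(\<Sum>i\<in>UNIV. \<Sum>j\<in>UNIV.
        mult_operator (hamilton_coeff i f * pol_deriv i (hamilton_coeff j g)) * weyl_D j)
      = (\<Sum>j\<in>UNIV. mult_operator (poisson f (hamilton_coeff j g)) * weyl_D j)"
    by (subst sum.swap) (simp add: poisson_eq_sum mult_operator_sum sum_distrib_right)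
  also have "(\<Sum>i\<in>UNIV. \<Sum>j\<in>UNIV.
        mult_operator (hamilton_coeff j g * pol_deriv j (hamilton_coeff i f)) * weyl_D i)
      = (\<Sum>i\<in>UNIV. mult_operator (poisson g (hamilton_coeff i f)) * weyl_D i)"
    by (simp add: poisson_eq_sum mult_operator_sum sum_distrib_right)
  finally show ?thesis
    by (simp add: hamiltonian_eq_sum hamilton_coeff_poisson mult_operator_diff left_diff_distrib
        sum_subtractf)
qed

text \<open>With \<open>commutator_hamiltonian\<close>, two Hamiltonian derivations commute as soon
  as the bracket of their functions is constant, even a nonzero constant.\<close>

lemma hamiltonian_const: "hamiltonian (pol_const c) = 0"
  by (simp add: hamiltonian_def pol_deriv_const mult_operator_zero)


section \<open>The action on polynomials\<close>

text \<open>Linear endomorphisms form a type of their own so that composition can be the ring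
  product. Linearity over constants is what makes the scalars central.\<close>

typedef linear_endo =
  "{f :: poly4 \<Rightarrow> poly4. (\<forall>a b. f (a + b) = f a
      + f b) \<and> (\<forall>c a. f (pol_const c * a) = pol_const c * f a)}"
  by (rule exI[of _ id]) simp

setup_lifting type_definition_linear_endo

instantiation linear_endo :: "{ring, monoid_mult}"
begin

lift_definition zero_linear_endo :: linear_endo is "\<lambda>_. 0" by simp

lift_definition one_linear_endo :: linear_endo is "\<lambda>a. a" by simp

lift_definition plus_linear_endo :: "linear_endo \<Rightarrow> linear_endo \<Rightarrow> linear_endo"
  is "\<lambda>f g a. f a + g a"
  by (simp add: algebra_simps)

lift_definition uminus_linear_endo :: "linear_endo \<Rightarrow> linear_endo" is "\<lambda>f a. - f a"
  by simp

lift_definition minus_linear_endo :: "linear_endo \<Rightarrow> linear_endo \<Rightarrow> linear_endo"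
  is "\<lambda>f g a. f a - g a"
  by (simp add: algebra_simps)

lift_definition times_linear_endo :: "linear_endo \<Rightarrow> linear_endo \<Rightarrow> linear_endo"
  is "\<lambda>f g a. f (g a)"
  by simp

instance
  by standard (transfer; simp add: fun_eq_iff algebra_simps)+

end

definition mult_endo :: "poly4 \<Rightarrow> linear_endo" where
  "mult_endo f = Abs_linear_endo ((*) f)"

definition deriv_endo :: "4 \<Rightarrow> linear_endo" where
  "deriv_endo i = Abs_linear_endo (pol_deriv i)"

lemma Rep_mult_endo: "Rep_linear_endo (mult_endo f) = (*) f"
  by (simp add: mult_endo_def Abs_linear_endo_inverse algebra_simps)

lemma Rep_deriv_endo: "Rep_linear_endo (deriv_endo i) = pol_deriv i"
  by (simp add: deriv_endo_def Abs_linear_endo_inverse pol_deriv_add pol_deriv_mult pol_deriv_const)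

lemma Rep_linear_endo_scale:
  "Rep_linear_endo r (pol_const c * f) = pol_const c * Rep_linear_endo r f"
  using Rep_linear_endo[of r] by simp

lemma linear_endo_eqI:
  "(\<And>f. Rep_linear_endo r f = Rep_linear_endo s f) \<Longrightarrow> r = s"
  by (simp add: fun_eq_iff flip: Rep_linear_endo_inject)

lemmas linear_endo_rep_eqs =
  zero_linear_endo.rep_eq one_linear_endo.rep_eq plus_linear_endo.rep_eq minus_linear_endo.rep_eq
  times_linear_endo.rep_eq Rep_mult_endo Rep_deriv_endo

interpretation action: weyl_representation
  "\<lambda>c. mult_endo (pol_const c)" "\<lambda>i. mult_endo (pol_var i)" deriv_endo
proof
  fix c d i j r
  show "mult_endo (pol_const (c + d)) = mult_endo (pol_const c) + mult_endo (pol_const d)"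
    by (rule linear_endo_eqI) (simp add: linear_endo_rep_eqs pol_const_add distrib_right)
  show "mult_endo (pol_const (c * d)) = mult_endo (pol_const c) * mult_endo (pol_const d)"
    by (rule linear_endo_eqI) (simp add: linear_endo_rep_eqs pol_const_mult mult.assoc)
  show "mult_endo (pol_const 1) = 1"
    by (rule linear_endo_eqI) (simp add: linear_endo_rep_eqs pol_const_one)
  show "mult_endo (pol_const c) * r = r * mult_endo (pol_const c)"
    by (rule linear_endo_eqI) (simp add: linear_endo_rep_eqs Rep_linear_endo_scale)
  show "commutator (deriv_endo i) (mult_endo (pol_var j)) = (if i = j then 1 else 0)"
    by (rule linear_endo_eqI)
      (auto simp: commutator_def linear_endo_rep_eqs pol_deriv_mult pol_deriv_var)
  show "commutator (mult_endo (pol_var i)) (mult_endo (pol_var j)) = 0"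
    by (rule linear_endo_eqI) (simp add: commutator_def linear_endo_rep_eqs algebra_simps)
  show "commutator (deriv_endo i) (deriv_endo j) = 0"
    by (rule linear_endo_eqI)
      (simp add: commutator_def linear_endo_rep_eqs pol_deriv_commute[of i j])
qed

definition weyl_act :: "4 weyl \<Rightarrow> poly4 \<Rightarrow> poly4" where
  "weyl_act w = Rep_linear_endo (action.lift w)"

lemma weyl_act_add: "weyl_act (v + w) f = weyl_act v f + weyl_act w f"
  by (simp add: weyl_act_def action.lift_add plus_linear_endo.rep_eq)

lemma weyl_act_mult: "weyl_act (v * w) f = weyl_act v (weyl_act w f)"
  by (simp add: weyl_act_def action.lift_mult times_linear_endo.rep_eq)

lemma weyl_act_uminus: "weyl_act (- w) f = - weyl_act w f"
  \<comment> \<open>The second instance yields \<open>weyl_act 0 f = 0\<close>.\<close>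
  using weyl_act_add[of w "- w" f] weyl_act_add[of 0 0 f] by (simp add: eq_neg_iff_add_eq_0 add.commute)

lemma weyl_act_diff: "weyl_act (v - w) f = weyl_act v f - weyl_act w f"
  using weyl_act_add[of v "- w" f] by (simp add: weyl_act_uminus)

lemma weyl_act_scalar: "weyl_act (weyl_scale c 1) f = pol_const c * f"
  by (simp add: weyl_act_def action.lift_scale action.lift_one Rep_mult_endo)

lemma weyl_act_X: "weyl_act (weyl_X i) f = pol_var i * f"
  by (simp add: weyl_act_def action.lift_X Rep_mult_endo)

lemma weyl_act_D: "weyl_act (weyl_D i) f = pol_deriv i f"
  by (simp add: weyl_act_def action.lift_D Rep_deriv_endo)

lemma weyl_act_mult_operator: "weyl_act (mult_operator f) g = f * g"
  by (induction f arbitrary: g rule: poly4_induct)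
    (simp_all add: mult_operator_const mult_operator_var mult_operator_add mult_operator_mult
      weyl_act_scalar weyl_act_X weyl_act_add weyl_act_mult algebra_simps)

lemma weyl_act_hamiltonian: "weyl_act (hamiltonian f) g = poisson f g"
  by (simp add: hamiltonian_def weyl_act_add weyl_act_diff weyl_act_mult weyl_act_mult_operator
      weyl_act_D poisson_def)

section \<open>The brackets of \<open>R\<close>, \<open>T\<close>, \<open>D\<close>, \<open>S\<close>\<close>

lemma pol_deriv_power: "pol_deriv i (f ^ n) = of_nat n * f ^ (n - 1) * pol_deriv i f"
proof (induction n)
  case (Suc n)
  then show ?case
    by (cases n) (simp_all add: pol_deriv_mult algebra_simps)
qed (simp add: pol_deriv_one)

lemma poisson_derivation_right:
  "poisson f (g + h) = poisson f g + poisson f h"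
  "poisson f (g - h) = poisson f g - poisson f h"
  "poisson f (- g) = - poisson f g"
  "poisson f (g * h) = poisson f g * h + g * poisson f h"
  "poisson f (g ^ n) = of_nat n * g ^ (n - 1) * poisson f g"
  "poisson f 0 = 0"
  "poisson f 1 = 0"
  "poisson f (numeral k) = 0"
  "poisson f (pol_const c) = 0"
  by (simp_all add: poisson_def pol_deriv_add pol_deriv_diff pol_deriv_uminus pol_deriv_mult
      pol_deriv_power pol_deriv_zero pol_deriv_one pol_deriv_numeral pol_deriv_const algebra_simps)

lemma poisson_derivation_left:
  "poisson (f + g) h = poisson f h + poisson g h"
  "poisson (f - g) h = poisson f h - poisson g h"
  "poisson (- f) h = - poisson f h"
  "poisson (f * g) h = poisson f h * g + f * poisson g h"
  "poisson (f ^ n) h = of_nat n * f ^ (n - 1) * poisson f h"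
  "poisson 0 h = 0"
  "poisson 1 h = 0"
  "poisson (numeral k) h = 0"
  "poisson (pol_const c) h = 0"
  unfolding poisson_anticommute[of _ h] by (simp_all add: poisson_derivation_right)

lemmas poisson_derivation = poisson_derivation_left poisson_derivation_right

lemma poisson_self: "poisson f f = 0"
  by (simp add: poisson_def)

section \<open>Brackets of the coordinates and of x, y, beta\<close>

lemma poisson_coordinates:
  "poisson pol_p pol_x = 1" "poisson pol_x pol_p = - 1"
  "poisson pol_z pol_q = 1" "poisson pol_q pol_z = - 1"
  "poisson pol_x pol_q = 0" "poisson pol_q pol_x = 0"
  "poisson pol_x pol_z = 0" "poisson pol_z pol_x = 0"
  "poisson pol_p pol_q = 0" "poisson pol_q pol_p = 0"
  "poisson pol_p pol_z = 0" "poisson pol_z pol_p = 0"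
  by (simp_all add: poisson_def pol_x_def pol_q_def pol_p_def pol_z_def pol_deriv_var)

text \<open>Identities are proved with denominators cleared, since constants such as
  \<open>pol_const (1/3)\<close> are mere atoms for \<open>algebra\<close>; this divides the integer
  out again.\<close>

lemma pol_numeral_cancel:
  fixes f g :: poly4
  shows "numeral k * f = numeral k * g \<Longrightarrow> f = g"
  by simp

lemma three_pol_y: "3 * pol_y = 3 * pol_q - pol_x * pol_beta"
proof -
  have "3 * pol_const (1/3) = 1"
    by (simp add: pol_const_one flip: pol_const_numeral pol_const_mult)
  then show ?thesis unfolding pol_y_def by algebra
qed

text \<open>The means of eliminating q in favour of x, y, beta.\<close>

lemma three_pol_q: "3 * pol_q = 3 * pol_y + pol_x * pol_beta"
  using three_pol_y by algebra

lemma poisson_x_beta: "poisson pol_x pol_beta = - 3 * pol_x^2"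
  by (simp add: pol_beta_def pol_B_def pol_a_def poisson_derivation poisson_coordinates poisson_self)

lemma poisson_q_beta: "poisson pol_q pol_beta = 6 * pol_x * pol_q - 2"
  by (simp add: pol_beta_def pol_B_def pol_a_def poisson_derivation poisson_coordinates poisson_self)

lemma poisson_x_y: "poisson pol_x pol_y = pol_x^3"
proof -
  have "3 * poisson pol_x pol_y = poisson pol_x (3 * pol_y)"
    by (simp add: poisson_derivation)
  also have "\<dots> = 3 * pol_x^3"
    unfolding three_pol_y
    by (simp add: poisson_derivation poisson_coordinates poisson_self poisson_x_beta power2_eq_square power3_eq_cube)
  finally show ?thesis by simp
qed

lemma poisson_y_beta: "poisson pol_y pol_beta = 6 * pol_x * pol_y + 3 * pol_x^2 * pol_beta - 2"
proof -
  have "3 * poisson pol_y pol_beta = poisson (3 * pol_y) pol_beta"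
    by (simp add: poisson_derivation)
  also have "\<dots> = 3 * (6 * pol_x * pol_y + 3 * pol_x^2 * pol_beta - 2)"
    unfolding three_pol_y
    by (simp add: poisson_derivation poisson_coordinates poisson_self poisson_x_beta poisson_q_beta)
      (insert three_pol_y, algebra)
  finally show ?thesis by (rule pol_numeral_cancel)
qed

text \<open>The full bracket table of the Poisson subalgebra generated by x, y, beta. Both orders
  are listed, since the expansions below produce either.\<close>

lemmas poisson_xyb = poisson_x_y poisson_x_beta poisson_y_beta
  poisson_anticommute[of pol_y pol_x, unfolded poisson_x_y]
  poisson_anticommute[of pol_beta pol_x, unfolded poisson_x_beta]
  poisson_anticommute[of pol_beta pol_y, unfolded poisson_y_beta]
  poisson_self

section \<open>T, S and H as polynomials in x, y, beta, and the chain rule\<close>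

lemma two_pol_T:
  "2 * pol_T = - ((1 + pol_u)^3 * pol_beta + pol_y^2 * (1 + pol_u) * (4 + 3 * pol_u))"
proof -
  have "2 * pol_const (1/2) = 1"
    by (simp add: pol_const_one flip: pol_const_numeral pol_const_mult)
  then have "2 * (- pol_const (1/2) * f) = - f" for f
    by (simp flip: mult.assoc)
  then show ?thesis unfolding pol_T_def .
qed

lemma pol_S_expand:
  "pol_S = pol_y + 3 * pol_x * pol_beta + 12 * pol_x * pol_y^2 + 6 * pol_x^2 * pol_y * pol_beta
      + 9 * pol_x^2 * pol_y^3 + 3 * pol_x^3 * pol_y^2 * pol_beta"
  unfolding pol_S_def pol_u_def by algebra

lemma two_pol_T_expand:
  "2 * pol_T = - pol_beta - 4 * pol_y^2 - 3 * pol_x * pol_y * pol_beta - 7 * pol_x * pol_y^3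
      - 3 * pol_x^2 * pol_y^2 * pol_beta - 3 * pol_x^2 * pol_y^4 - pol_x^3 * pol_y^3 * pol_beta"
  unfolding two_pol_T pol_u_def by algebra

text \<open>The factor 60 is the least common multiple of the denominators 20, 10 and 6.\<close>

lemma sixty_pol_H:
  "60 * pol_H = - 20 * pol_beta^2 - 90 * pol_y^2 * pol_beta + 375 * pol_y^4
      - 90 * pol_x * pol_y * pol_beta^2 + 180 * pol_x * pol_y^3 * pol_beta + 234 * pol_x * pol_y^5
      - 10 * pol_x^2 * pol_beta^3 + 90 * pol_x^2 * pol_y^4 * pol_beta + 54 * pol_x^2 * pol_y^6
      + 18 * pol_x^3 * pol_y^5 * pol_beta"
proof -
  \<comment> \<open>This mirrors the shape of \<open>pol_H\<close>, whose last two terms share the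
    coefficient 1/6, and turns the coefficients into integers.\<close>
  have scale: "60 * (pol_const c * f + pol_const d * g - pol_const e * h - pol_const e * k)
      = pol_const (60 * c) * f + pol_const (60 * d) * g - pol_const (60 * e) * h
          - pol_const (60 * e) * k"
    for c d e f g h k
    by (simp add: pol_const_mult pol_const_numeral algebra_simps)
  show ?thesis unfolding pol_H_def pol_u_def mult.assoc scale
    by (simp add: pol_const_numeral algebra_simps eval_nat_numeral)
qed

text \<open>Chain rule: the coefficients are the partial derivatives of R as a polynomial in x, y,
  beta. The first argument stays arbitrary, so that it can be a generator x, y, beta as well as S or
  D. The next three lemmas do the same for S, 2T and 60H.\<close>

lemma poisson_R:
  "poisson f pol_R = (2 - 6 * pol_x * pol_y - 3 * pol_x^2 * pol_beta) * poisson f pol_x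
      + (- 3 * pol_x^2) * poisson f pol_y + (- (pol_x^3)) * poisson f pol_beta"
  unfolding pol_R_def by (simp add: poisson_derivation) algebra

lemma poisson_S:
  "poisson f pol_S =
     (3 * pol_beta + 12 * pol_y^2 + 12 * pol_x * pol_y * pol_beta + 18 * pol_x * pol_y^3
         + 9 * pol_x^2 * pol_y^2 * pol_beta) * poisson f pol_x
     + (1 + 24 * pol_x * pol_y + 6 * pol_x^2 * pol_beta + 27 * pol_x^2 * pol_y^2
         + 6 * pol_x^3 * pol_y * pol_beta) * poisson f pol_y
     + (3 * pol_x + 6 * pol_x^2 * pol_y + 3 * pol_x^3 * pol_y^2) * poisson f pol_beta"
  unfolding pol_S_expand by (simp add: poisson_derivation) algebra

lemma poisson_T:
  "2 * poisson f pol_T =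
     (- 3 * pol_y * pol_beta - 7 * pol_y^3 - 6 * pol_x * pol_y^2 * pol_beta - 6 * pol_x * pol_y^4
         - 3 * pol_x^2 * pol_y^3 * pol_beta) * poisson f pol_x
     + (- 8 * pol_y - 3 * pol_x * pol_beta - 21 * pol_x * pol_y^2 - 6 * pol_x^2 * pol_y * pol_beta
         - 12 * pol_x^2 * pol_y^3 - 3 * pol_x^3 * pol_y^2 * pol_beta) * poisson f pol_y
     + (- 1 - 3 * pol_x * pol_y - 3 * pol_x^2 * pol_y^2 - pol_x^3 * pol_y^3) * poisson f pol_beta"
  (is "_ = ?rhs")
proof -
  have "2 * poisson f pol_T = poisson f (2 * pol_T)"
    by (simp add: poisson_derivation)
  also have "\<dots> = ?rhs"
    unfolding two_pol_T_expand by (simp add: poisson_derivation) algebra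
  finally show ?thesis .
qed

lemma poisson_H:
  "60 * poisson f pol_H =
     (- 90 * pol_y * pol_beta^2 + 180 * pol_y^3 * pol_beta + 234 * pol_y^5
         - 20 * pol_x * pol_beta^3 + 180 * pol_x * pol_y^4 * pol_beta + 108 * pol_x * pol_y^6
         + 54 * pol_x^2 * pol_y^5 * pol_beta) * poisson f pol_x
     + (- 180 * pol_y * pol_beta + 1500 * pol_y^3 - 90 * pol_x * pol_beta^2
         + 540 * pol_x * pol_y^2 * pol_beta + 1170 * pol_x * pol_y^4
         + 360 * pol_x^2 * pol_y^3 * pol_beta + 324 * pol_x^2 * pol_y^5
         + 90 * pol_x^3 * pol_y^4 * pol_beta) * poisson f pol_y
     + (- 40 * pol_beta - 90 * pol_y^2 - 180 * pol_x * pol_y * pol_beta + 180 * pol_x * pol_y^3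
         - 30 * pol_x^2 * pol_beta^2 + 90 * pol_x^2 * pol_y^4
         + 18 * pol_x^3 * pol_y^5) * poisson f pol_beta"
  (is "_ = ?rhs")
proof -
  have "60 * poisson f pol_H = poisson f (60 * pol_H)"
    by (simp add: poisson_derivation)
  also have "\<dots> = ?rhs"
    unfolding sixty_pol_H by (simp add: poisson_derivation) algebra
  finally show ?thesis .
qed

section \<open>Brackets between R, S and T\<close>

lemma poisson_S_x:
  "poisson pol_S pol_x = 8 * pol_x^3 - 6 * pol_x^4 * pol_y - 6 * pol_x^5 * pol_beta
      - 18 * pol_x^5 * pol_y^2 - 6 * pol_x^6 * pol_y * pol_beta"
  unfolding poisson_anticommute[of pol_S pol_x] poisson_S poisson_xyb by algebra

lemma poisson_S_y:
  "poisson pol_S pol_y = 6 * pol_x - 6 * pol_x^2 * pol_y - 6 * pol_x^3 * pol_beta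
      - 18 * pol_x^3 * pol_y^2 - 6 * pol_x^4 * pol_y * pol_beta"
  unfolding poisson_anticommute[of pol_S pol_y] poisson_S poisson_xyb by algebra

lemma poisson_S_beta:
  "poisson pol_S pol_beta = - 2 - 42 * pol_x * pol_y - 18 * pol_x^2 * pol_beta
      + 54 * pol_x^2 * pol_y^2 + 60 * pol_x^3 * pol_y * pol_beta + 108 * pol_x^3 * pol_y^3
      + 18 * pol_x^4 * pol_beta^2 + 90 * pol_x^4 * pol_y^2 * pol_beta
      + 18 * pol_x^5 * pol_y * pol_beta^2"
  unfolding poisson_anticommute[of pol_S pol_beta] poisson_S poisson_xyb by algebra

text \<open>The bracket with S is a derivation, so its values on x, y, beta determine it on R
  through the chain rule.\<close>

lemma poisson_S_R: "poisson pol_S pol_R = 0"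
  unfolding poisson_R poisson_S_x poisson_S_y poisson_S_beta by algebra

lemma poisson_S_T: "poisson pol_S pol_T = 1"
proof -
  have "2 * poisson pol_S pol_T - 2 = 0"
    unfolding poisson_T poisson_S_x poisson_S_y poisson_S_beta by algebra
  then show ?thesis by simp
qed

text \<open>R is a Casimir of the Poisson subalgebra generated by x, y, beta: it commutes with each
  of the three generators, and therefore with T.\<close>

lemma poisson_R_x: "poisson pol_R pol_x = 0"
  unfolding poisson_anticommute[of pol_R pol_x] poisson_R poisson_xyb by algebra

lemma poisson_R_y: "poisson pol_R pol_y = 0"
  unfolding poisson_anticommute[of pol_R pol_y] poisson_R poisson_xyb by algebra

lemma poisson_R_beta: "poisson pol_R pol_beta = 0"
  unfolding poisson_anticommute[of pol_R pol_beta] poisson_R poisson_xyb by algebra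

lemma poisson_R_T: "poisson pol_R pol_T = 0"
proof -
  have "2 * poisson pol_R pol_T = 0"
    unfolding poisson_T poisson_R_x poisson_R_y poisson_R_beta by algebra
  then show ?thesis by simp
qed

section \<open>Brackets of D with R, S and T\<close>

lemma two_pol_D0: "2 * pol_D0 = (1 + 3 * pol_x * pol_q) * pol_p - 6 * pol_q^2 * pol_z"
proof -
  have "2 * pol_const (1/2) = 1"
    by (simp add: pol_const_one flip: pol_const_numeral pol_const_mult)
  then show ?thesis unfolding pol_D0_def by algebra
qed

text \<open>\<open>pol_D0\<close> is not a polynomial in x, y, beta, but its bracket preserves the
  subalgebra they generate: q enters the values only through 3q, which \<open>three_pol_q\<close>
  replaces.\<close>

lemma poisson_D0_x: "2 * poisson pol_D0 pol_x = 1 + pol_x * (3 * pol_y + pol_x * pol_beta)"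
proof -
  have "2 * poisson pol_D0 pol_x = poisson (2 * pol_D0) pol_x"
    by (simp add: poisson_derivation)
  also have "\<dots> = 1 + pol_x * (3 * pol_q)"
    unfolding two_pol_D0 by (simp add: poisson_derivation poisson_coordinates poisson_self)
  finally show ?thesis unfolding three_pol_q .
qed

lemma poisson_D0_q: "3 * poisson pol_D0 pol_q = - ((3 * pol_y + pol_x * pol_beta)^2)"
proof -
  have "2 * (3 * poisson pol_D0 pol_q) = 3 * poisson (2 * pol_D0) pol_q"
    by (simp add: poisson_derivation)
  also have "\<dots> = 2 * (- ((3 * pol_q)^2))"
    unfolding two_pol_D0 by (simp add: poisson_derivation poisson_coordinates poisson_self power_mult_distrib)
  finally have "3 * poisson pol_D0 pol_q = - ((3 * pol_q)^2)"
    by (rule pol_numeral_cancel)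
  then show ?thesis unfolding three_pol_q .
qed

lemma poisson_D0_beta:
  "2 * poisson pol_D0 pol_beta =
     3 * (3 * pol_y + pol_x * pol_beta) * pol_beta + 7 * (3 * pol_y + pol_x * pol_beta)^3"
proof -
  have "2 * poisson pol_D0 pol_beta = poisson (2 * pol_D0) pol_beta"
    by (simp add: poisson_derivation)
  also have "\<dots> = 3 * (3 * pol_q) * pol_beta + 7 * (3 * pol_q)^3"
    \<comment> \<open>As \<open>pol_D0\<close> is given in coordinates, beta is expanded too; the
      terms with p and z recombine into beta.\<close>
    unfolding two_pol_D0 unfolding pol_beta_def pol_B_def pol_a_def
    by (simp add: poisson_derivation poisson_coordinates poisson_self) algebra
  finally show ?thesis unfolding three_pol_q .
qed

lemma poisson_D0_y:
  "6 * poisson pol_D0 pol_y = - 2 * (3 * pol_y + pol_x * pol_beta)^2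
     - (1 + pol_x * (3 * pol_y + pol_x * pol_beta)) * pol_beta
     - pol_x * (3 * (3 * pol_y + pol_x * pol_beta) * pol_beta + 7 * (3 * pol_y
         + pol_x * pol_beta)^3)"
proof -
  have "6 * poisson pol_D0 pol_y = 2 * poisson pol_D0 (3 * pol_y)"
    by (simp add: poisson_derivation)
  also have "\<dots> = 2 * (3 * poisson pol_D0 pol_q) - (2 * poisson pol_D0 pol_x) * pol_beta
      - pol_x * (2 * poisson pol_D0 pol_beta)"
    unfolding three_pol_y by (simp add: poisson_derivation algebra_simps)
  finally show ?thesis
    unfolding poisson_D0_x poisson_D0_beta poisson_D0_q by algebra
qed

text \<open>The contribution of \<open>pol_D0\<close> is known; that of \<open>pol_H\<close> comes
  from the chain rule after exchanging the arguments, hence the minus sign. The factor 60 clears all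
  denominators.\<close>

lemma poisson_D_x:
  "60 * poisson pol_D pol_x = 30 + 90 * pol_x * pol_y - 90 * pol_x^2 * pol_beta
      - 270 * pol_x^2 * pol_y^2 - 360 * pol_x^3 * pol_y * pol_beta - 960 * pol_x^3 * pol_y^3
      - 540 * pol_x^4 * pol_y^2 * pol_beta - 900 * pol_x^4 * pol_y^4
      - 360 * pol_x^5 * pol_y^3 * pol_beta - 270 * pol_x^5 * pol_y^5
      - 90 * pol_x^6 * pol_y^4 * pol_beta"
proof -
  have "60 * poisson pol_D pol_x = 30 * (2 * poisson pol_D0 pol_x) - 60 * poisson pol_x pol_H"
    by (simp add: pol_D_def poisson_derivation poisson_anticommute[of pol_H pol_x])
  then show ?thesis
    unfolding poisson_D0_x poisson_H poisson_xyb by algebra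
qed

lemma poisson_D_y:
  "60 * poisson pol_D pol_y = - 90 * pol_beta - 360 * pol_y^2 - 360 * pol_x * pol_y * pol_beta
      - 990 * pol_x * pol_y^3 - 540 * pol_x^2 * pol_y^2 * pol_beta - 900 * pol_x^2 * pol_y^4
      - 360 * pol_x^3 * pol_y^3 * pol_beta - 270 * pol_x^3 * pol_y^5
      - 90 * pol_x^4 * pol_y^4 * pol_beta"
proof -
  have "60 * poisson pol_D pol_y = 10 * (6 * poisson pol_D0 pol_y) - 60 * poisson pol_y pol_H"
    by (simp add: pol_D_def poisson_derivation poisson_anticommute[of pol_H pol_y])
  then show ?thesis
    unfolding poisson_D0_y poisson_H poisson_xyb by algebra
qed

lemma poisson_D_beta:
  "60 * poisson pol_D pol_beta = 630 * pol_y * pol_beta + 2670 * pol_y^3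
      + 270 * pol_x * pol_beta^2 + 3510 * pol_x * pol_y^2 * pol_beta + 6660 * pol_x * pol_y^4
      + 1080 * pol_x^2 * pol_y * pol_beta^2 + 6480 * pol_x^2 * pol_y^3 * pol_beta
      + 5670 * pol_x^2 * pol_y^5 + 1620 * pol_x^3 * pol_y^2 * pol_beta^2
      + 4950 * pol_x^3 * pol_y^4 * pol_beta + 1620 * pol_x^3 * pol_y^6
      + 1080 * pol_x^4 * pol_y^3 * pol_beta^2 + 1350 * pol_x^4 * pol_y^5 * pol_beta
      + 270 * pol_x^5 * pol_y^4 * pol_beta^2"
proof -
  have "60 * poisson pol_D pol_beta = 30 * (2 * poisson pol_D0 pol_beta)
      - 60 * poisson pol_beta pol_H"
    by (simp add: pol_D_def poisson_derivation poisson_anticommute[of pol_H pol_beta])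
  then show ?thesis
    unfolding poisson_D0_beta poisson_H poisson_xyb by algebra
qed

text \<open>Moves the factor 60 onto the three brackets, whose values are available only in that
  multiplied form.\<close>

lemma sixty_poisson_D_distrib:
  "60 * (f * poisson pol_D pol_x + g * poisson pol_D pol_y + h * poisson pol_D pol_beta)
     = f * (60 * poisson pol_D pol_x) + g * (60 * poisson pol_D pol_y)
         + h * (60 * poisson pol_D pol_beta)"
  by (simp add: algebra_simps)

lemma poisson_D_R: "poisson pol_D pol_R = 1"
proof -
  have "60 * poisson pol_D pol_R - 60 = 0"
    unfolding poisson_R sixty_poisson_D_distrib poisson_D_x poisson_D_y poisson_D_beta by algebra
  then show ?thesis by simp
qed

lemma poisson_D_S: "poisson pol_D pol_S = 0"
proof -
  have "60 * poisson pol_D pol_S = 0"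
    unfolding poisson_S sixty_poisson_D_distrib poisson_D_x poisson_D_y poisson_D_beta by algebra
  then show ?thesis by simp
qed

lemma poisson_D_T: "poisson pol_D pol_T = 0"
proof -
  have "60 * (2 * poisson pol_D pol_T) = 0"
    unfolding poisson_T sixty_poisson_D_distrib poisson_D_x poisson_D_y poisson_D_beta by algebra
  then show ?thesis by simp
qed

section \<open>The endomorphism\<close>

definition image_X :: "4 \<Rightarrow> poly4" where
  "image_X i = (if i = 1 then pol_R else if i = 2 then pol_T else if i = 3 then pol_D else pol_S)"

text \<open>Hamiltonian functions of the derivations \<delta>_i; the signs in \<delta>_3 and
  \<delta>_4 are absorbed into the functions.\<close>

definition image_D :: "4 \<Rightarrow> poly4" where
  "image_D i = (if i = 1 then pol_D else if i = 2 then pol_S else if i = 3 then - pol_R else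
      - pol_T)"

lemmas poisson_images =
  poisson_S_R poisson_S_T poisson_R_T poisson_D_R poisson_D_S poisson_D_T poisson_self
  poisson_anticommute[of pol_R pol_S, unfolded poisson_S_R]
  poisson_anticommute[of pol_T pol_S, unfolded poisson_S_T]
  poisson_anticommute[of pol_T pol_R, unfolded poisson_R_T]
  poisson_anticommute[of pol_R pol_D, unfolded poisson_D_R]
  poisson_anticommute[of pol_S pol_D, unfolded poisson_D_S]
  poisson_anticommute[of pol_T pol_D, unfolded poisson_D_T]

lemma poisson_image_D_image_X: "poisson (image_D i) (image_X j) = (if i = j then 1 else 0)"
  using exhaust_4[of i] exhaust_4[of j]
  by (elim disjE) (simp_all add: image_D_def image_X_def poisson_derivation_left poisson_images)

text \<open>The brackets are not all 0: D with -R and S with -T give -1. Constancy is enough,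
  because \<open>hamiltonian\<close> kills constants.\<close>

lemma poisson_image_D_image_D: "\<exists>c. poisson (image_D i) (image_D j) = pol_const c"
proof -
  have "poisson (image_D i) (image_D j) \<in> {0, 1, - 1}"
    using exhaust_4[of i] exhaust_4[of j]
    by (elim disjE) (simp_all add: image_D_def poisson_derivation poisson_images)
  then show ?thesis
    by (metis empty_iff insert_iff pol.scalar_zero pol_const_one pol_const_uminus)
qed

lemma commutator_mult_operator: "commutator (mult_operator f) (mult_operator g) = 0"
  by (simp add: commutator_def mult_operator_commute[of f g])

interpretation Phi: weyl_representation "\<lambda>c. weyl_scale c (1 :: 4 weyl)"
  "\<lambda>i. mult_operator (image_X i)" "\<lambda>i. hamiltonian (image_D i)"
proof
  fix i j
  show "commutator (hamiltonian (image_D i)) (mult_operator (image_X j)) = (if i = j then 1 else 0)"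
    by (simp add: commutator_hamiltonian_mult_operator poisson_image_D_image_X mult_operator_one
        mult_operator_zero)
  show "commutator (mult_operator (image_X i)) (mult_operator (image_X j)) = 0"
    by (rule commutator_mult_operator)
  show "commutator (hamiltonian (image_D i)) (hamiltonian (image_D j)) = 0"
    using poisson_image_D_image_D[of i j] by (auto simp: commutator_hamiltonian hamiltonian_const)
qed

lemma hamiltonian_uminus: "hamiltonian (- f) = - hamiltonian f"
  by (simp add: hamiltonian_def pol_deriv_uminus mult_operator_uminus)

lemma extends_assignment_iff:
  "extends_assignment \<Phi> \<longleftrightarrow>
     (\<forall>i. \<Phi> (weyl_X i) = mult_operator (image_X i) \<and> \<Phi> (weyl_D i)
         = hamiltonian (image_D i))"
  by (auto simp: extends_assignment_def forall_4 image_X_def image_D_def hamiltonian_uminus)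

lemma weyl_endomorphism_Phi: "weyl_endomorphism Phi.lift"
  by (simp add: weyl_endomorphism_def Phi.lift_add Phi.lift_mult Phi.lift_one Phi.lift_scale
      weyl_scale_one_mult)

lemma extends_assignment_Phi: "extends_assignment Phi.lift"
  by (simp add: extends_assignment_iff Phi.lift_X Phi.lift_D)

lemma weyl_endomorphism_eqI:
  assumes "weyl_endomorphism \<phi>" "weyl_endomorphism \<psi>"
    and "\<And>i. \<phi> (weyl_X i) = \<psi> (weyl_X i)" "\<And>i. \<phi> (weyl_D i)
        = \<psi> (weyl_D i)"
  shows "\<phi> = \<psi>"
proof
  fix w
  show "\<phi> w = \<psi> w"
    by (induction w rule: weyl_induct) (use assms in \<open>simp_all add: weyl_endomorphism_def\<close>)
qed


section \<open>Failure of surjectivity\<close>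

text \<open>The algebra of polynomials in R, T, D, S, inside the polynomial ring; it is not the
  image of the endomorphism in the Weyl algebra.\<close>

inductive_set image_algebra :: "poly4 set" where
  const: "pol_const c \<in> image_algebra"
| gen: "image_X i \<in> image_algebra"
| add: "f \<in> image_algebra \<Longrightarrow> g \<in> image_algebra \<Longrightarrow> f
    + g \<in> image_algebra"
| mult: "f \<in> image_algebra \<Longrightarrow> g \<in> image_algebra \<Longrightarrow> f * g \<in> image_algebra"

text \<open>The derivation sends each generator to 0 or 1, and the Leibniz rule does the
  rest.\<close>

lemma poisson_image_D_image_algebra:
  assumes "f \<in> image_algebra"
  shows "poisson (image_D i) f \<in> image_algebra"
proof -
  have "0 \<in> image_algebra" "1 \<in> image_algebra"
    using image_algebra.const[of 0] image_algebra.const[of 1]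
    by (simp_all add: pol.scalar_zero pol_const_one)
  with assms show ?thesis
    by (induction rule: image_algebra.induct)
      (auto simp: poisson_derivation_right poisson_image_D_image_X
        intro: image_algebra.intros)
qed

lemma weyl_act_image_algebra:
  assumes "weyl_endomorphism \<Phi>" "extends_assignment \<Phi>" "f \<in> image_algebra"
  shows "weyl_act (\<Phi> w) f \<in> image_algebra"
  using assms(3)
\<comment> \<open>In the product case \<open>v\<close> acts on the result of \<open>w\<close>, so
  \<open>f\<close> must vary.\<close>
proof (induction w arbitrary: f rule: weyl_induct)
  case (scalar c)
  have "\<Phi> (weyl_scale c 1) = weyl_scale c 1"
    using assms(1) by (simp add: weyl_endomorphism_def)
  with scalar show ?case
    by (simp add: weyl_act_scalar image_algebra.intros)
next
  case (X i)
  with assms(2) show ?case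
    by (simp add: extends_assignment_iff weyl_act_mult_operator image_algebra.intros)
next
  case (D i)
  with assms(2) show ?case
    by (simp add: extends_assignment_iff weyl_act_hamiltonian poisson_image_D_image_algebra)
next
  case (add v w)
  with assms(1) show ?case
    by (simp add: weyl_endomorphism_def weyl_act_add image_algebra.add)
next
  case (mult v w)
  with assms(1) show ?case
    by (simp add: weyl_endomorphism_def weyl_act_mult)
qed

definition collision_point :: "complex \<Rightarrow> 4 \<Rightarrow> complex" where
  "collision_point s i =
     (if i = 1 then s else if i = 2 then 2/3 * s else if i = 3 then 7/2 else 0)"

text \<open>The substitution (x, q, p, z) -> (-x, -q, p, z) exchanges the two points. T and D are
  even under it, hence agree; R and S are odd, and they vanish at both points.\<close>

lemma image_X_collision:
  "pol_at.eval (collision_point 1) (image_X i) = pol_at.eval (collision_point (- 1)) (image_X i)"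
proof -
  note ev = pol_at.eval_add pol_at.eval_diff pol_at.eval_uminus pol_at.eval_mult pol_at.eval_power
    pol_at.eval_one pol_at_const pol_at_numeral pol_at_var
  have coords: "pol_at.eval (collision_point s) pol_x = s" "pol_at.eval (collision_point s) pol_q
      = 2/3 * s"
    "pol_at.eval (collision_point s) pol_p = 7/2" "pol_at.eval (collision_point s) pol_z = 0" for s
    by (simp_all add: pol_x_def pol_q_def pol_p_def pol_z_def pol_at_var collision_point_def)
  \<comment> \<open>Assuming only \<open>s^2 = 1\<close> treats both points at once.\<close>
  have beta: "pol_at.eval (collision_point s) pol_beta = 13/2" if "s^2 = 1" for s
    using that by (simp add: pol_beta_def pol_B_def pol_a_def ev coords power_mult_distrib power2_eq_square)
  have y: "pol_at.eval (collision_point s) pol_y = - 3/2 * s" if "s^2 = 1" for s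
    using that by (simp add: pol_y_def ev coords beta)
  have u: "pol_at.eval (collision_point s) pol_u = - 3/2" if "s^2 = 1" for s
    using that by (simp add: pol_u_def ev coords y power2_eq_square)
  show ?thesis
    using exhaust_4[of i]
    by (elim disjE)
      (simp_all add: image_X_def pol_R_def pol_T_def pol_S_def pol_D_def pol_D0_def pol_H_def
        ev coords beta y u power2_eq_square power3_eq_cube)
qed

lemma image_algebra_collision:
  "f \<in> image_algebra \<Longrightarrow> pol_at.eval (collision_point 1) f
      = pol_at.eval (collision_point (- 1)) f"
  by (induction rule: image_algebra.induct)
    (simp_all add: pol_at_const image_X_collision pol_at.eval_add pol_at.eval_mult)

lemma not_surj_of_extends_assignment:
  assumes "weyl_endomorphism \<Phi>" "extends_assignment \<Phi>"
  shows "\<not> surj \<Phi>"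
proof
  assume "surj \<Phi>"
  then obtain w where "\<Phi> w = weyl_X 1" by (metis surjD)
  moreover have "1 \<in> image_algebra"
    using image_algebra.const[of 1] by (simp add: pol_const_one)
  \<comment> \<open>The constant 1 is the test vector: multiplication by x sends it to x
    itself.\<close>
  ultimately have "pol_var 1 \<in> image_algebra"
    using weyl_act_image_algebra[OF assms, of 1 w] by (simp add: weyl_act_X)
  from image_algebra_collision[OF this] show False
    by (simp add: pol_at_var collision_point_def)
qed

theorem theoremB1:
  "(\<exists>!\<Phi>. weyl_endomorphism \<Phi> \<and> extends_assignment \<Phi>)
   \<and> (\<forall>\<Phi>. weyl_endomorphism \<Phi> \<and> extends_assignment \<Phi> \<longrightarrow> \<not> weyl_automorphism \<Phi>)
   \<and> \<not> dixmier_conjecture TYPE(4)"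
proof -
  have unique: "\<exists>!\<Phi>. weyl_endomorphism \<Phi> \<and> extends_assignment \<Phi>"
  proof (rule ex1I[of _ Phi.lift])
    show "weyl_endomorphism Phi.lift \<and> extends_assignment Phi.lift"
      by (simp add: weyl_endomorphism_Phi extends_assignment_Phi)
  next
    fix \<Phi>
    assume "weyl_endomorphism \<Phi> \<and> extends_assignment \<Phi>"
    then show "\<Phi> = Phi.lift"
      using weyl_endomorphism_Phi extends_assignment_Phi
      by (intro weyl_endomorphism_eqI) (simp_all add: extends_assignment_iff)
  qed
  moreover have not_auto: "\<not> weyl_automorphism \<Phi>"
    if "weyl_endomorphism \<Phi>" "extends_assignment \<Phi>" for \<Phi>
    using not_surj_of_extends_assignment[OF that] by (auto simp: weyl_automorphism_def bij_def)
  moreover have "\<not> dixmier_conjecture TYPE(4)"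
    using weyl_endomorphism_Phi not_auto[OF weyl_endomorphism_Phi extends_assignment_Phi]
    by (auto simp: dixmier_conjecture_def)
  ultimately show ?thesis by blast
qed

end
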